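(* Let $(\Omega,\nu)$ be a diffuse standard probability space and let $1\leq p<\infty$ with $p\notin 2\mathbb{N}$. Then $L^p_0(\Omega,\nu)$ is not isometrically isomorphic to $L^p(\Omega',\mu)$ for any $\sigma$-finite measure space $(\Omega',\mu)$.
   Context: A diffuse standard probability space is a probability space isomorphic mod $0$ to the interval $[0,1]$ with the Lebesgue measure. All $L^p$-spaces are over $\mathbb{C}$. $L^p_0(\Omega,\nu)=\{f\in L^p(\Omega,\nu) : \int_\Omega f\,\mathrm{d}\nu=0\}$, equipped with the $L^p$-norm. Isometrically isomorphic means that there is a linear surjective isometry between the spaces. $2\mathbb{N}=\{2,4,6,\dots\}$ denotes the even positive integers. *)

theory Defs
  imports "HOL-Probability.Probability"
begin

section \<open>Diffuse standard probability spaces\<close>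

text \<open>
  An isomorphism mod 0 is a measure-preserving, bimeasurable bijection between conull subsets.
  Both measures are completed first, so that it does not matter whether a space carries
  its Borel sets or the completed sigma-algebra; for complete measures nothing changes.
\<close>

definition isomorphic_mod_0 :: "'a measure \<Rightarrow> 'b measure \<Rightarrow> bool" where
  "isomorphic_mod_0 M N \<longleftrightarrow>
    (\<exists>A\<in>sets (completion M). \<exists>B\<in>sets (completion N). \<exists>f g.
       let MA = restrict_space (completion M) A; NB = restrict_space (completion N) B in
         space M - A \<in> null_sets (completion M) \<and>
         space N - B \<in> null_sets (completion N) \<and>
         f \<in> measurable MA NB \<and> g \<in> measurable NB MA \<and>
         (\<forall>x\<in>A. g (f x) = x) \<and> (\<forall>y\<in>B. f (g y) = y) \<and>
         distr MA NB f = NB)"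

definition diffuse_standard_prob_space :: "'a measure \<Rightarrow> bool" where
  "diffuse_standard_prob_space M \<longleftrightarrow>
     prob_space M \<and> isomorphic_mod_0 M (lebesgue_on {0..1::real})"


section \<open>Isometric isomorphism of complex normed spaces\<close>

record 'v cnormed =
  vcarrier :: "'v set"
  vadd :: "'v \<Rightarrow> 'v \<Rightarrow> 'v"
  vscale :: "complex \<Rightarrow> 'v \<Rightarrow> 'v"
  vnorm :: "'v \<Rightarrow> real"

definition isometrically_isomorphic :: "'v cnormed \<Rightarrow> 'w cnormed \<Rightarrow> bool" where
  "isometrically_isomorphic X Y \<longleftrightarrow>
    (\<exists>T. T ` vcarrier X = vcarrier Y \<and>
       (\<forall>u\<in>vcarrier X. \<forall>v\<in>vcarrier X. T (vadd X u v) = vadd Y (T u) (T v)) \<and>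
       (\<forall>c. \<forall>u\<in>vcarrier X. T (vscale X c u) = vscale Y c (T u)) \<and>
       (\<forall>u\<in>vcarrier X. vnorm Y (T u) = vnorm X u))"


section \<open>Complex Lebesgue spaces\<close>

definition Lp_fun :: "real \<Rightarrow> 'a measure \<Rightarrow> ('a \<Rightarrow> complex) set" where
  "Lp_fun p M = {f \<in> borel_measurable M. integrable M (\<lambda>x. norm (f x) powr p)}"

definition Lp_seminorm :: "real \<Rightarrow> 'a measure \<Rightarrow> ('a \<Rightarrow> complex) \<Rightarrow> real" where
  "Lp_seminorm p M f = (LINT x|M. norm (f x) powr p) powr (1 / p)"

definition Lp_rel :: "real \<Rightarrow> 'a measure \<Rightarrow> (('a \<Rightarrow> complex) \<times> ('a \<Rightarrow> complex)) set" where
  "Lp_rel p M = {(f, g). f \<in> Lp_fun p M \<and> g \<in> Lp_fun p M \<and> (AE x in M. f x = g x)}"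

definition Lp_class :: "real \<Rightarrow> 'a measure \<Rightarrow> ('a \<Rightarrow> complex) \<Rightarrow> ('a \<Rightarrow> complex) set" where
  "Lp_class p M f = Lp_rel p M `` {f}"

text \<open>
  Vectors are equivalence classes of functions. The unions in the vector operations
  and the \<^const>\<open>the_elem\<close> in the norm are independent of representatives; see
  \<open>Lp_add_class\<close>, \<open>Lp_scale_class\<close> and \<open>Lp_norm_class\<close> below.
\<close>

definition Lp :: "real \<Rightarrow> 'a measure \<Rightarrow> ('a \<Rightarrow> complex) set cnormed" where
  "Lp p M =
    \<lparr> vcarrier = Lp_fun p M // Lp_rel p M,
      vadd = (\<lambda>F G. \<Union>f\<in>F. \<Union>g\<in>G. Lp_class p M (\<lambda>x. f x + g x)),
      vscale = (\<lambda>c F. \<Union>f\<in>F. Lp_class p M (\<lambda>x. c * f x)),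
      vnorm = (\<lambda>F. the_elem (Lp_seminorm p M ` F)) \<rparr>"

definition Lp0 :: "real \<Rightarrow> 'a measure \<Rightarrow> ('a \<Rightarrow> complex) set cnormed" where
  "Lp0 p M = (Lp p M)
    \<lparr> vcarrier := {F \<in> vcarrier (Lp p M). \<forall>f\<in>F. (LINT x|M. f x) = 0} \<rparr>"

lemma equiv_Lp_rel: "equiv (Lp_fun p M) (Lp_rel p M)"
proof (rule equivI)
  show "trans (Lp_rel p M)"
  proof (rule transI)
    fix f g h assume fgh: "(f, g) \<in> Lp_rel p M" "(g, h) \<in> Lp_rel p M"
    then have "AE x in M. f x = g x" "AE x in M. g x = h x" by (auto simp: Lp_rel_def)
    then have "AE x in M. f x = h x" by eventually_elim simp
    with fgh show "(f, h) \<in> Lp_rel p M" by (simp add: Lp_rel_def)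
  qed
  show "sym (Lp_rel p M)"
    by (rule symI) (simp add: Lp_rel_def eq_commute)
qed (auto simp: Lp_rel_def refl_on_def)

lemma Lp_class_eq_iff:
  assumes "f \<in> Lp_fun p M" "g \<in> Lp_fun p M"
  shows "Lp_class p M f = Lp_class p M g \<longleftrightarrow> (AE x in M. f x = g x)"
  using eq_equiv_class_iff[OF equiv_Lp_rel assms] assms
  by (auto simp: Lp_class_def Lp_rel_def)

lemma mem_Lp_class: "f \<in> Lp_fun p M \<Longrightarrow> f \<in> Lp_class p M f"
  by (simp add: Lp_class_def Lp_rel_def)

lemma Lp_fun_add:
  assumes "0 < p" "f \<in> Lp_fun p M" "g \<in> Lp_fun p M"
  shows "(\<lambda>x. f x + g x) \<in> Lp_fun p M"
proof -
  have [measurable]: "f \<in> borel_measurable M" "g \<in> borel_measurable M"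
    using assms by (auto simp: Lp_fun_def)
  have "integrable M (\<lambda>x. 2 powr p * (norm (f x) powr p + norm (g x) powr p))"
    using assms by (intro integrable_mult_right Bochner_Integration.integrable_add)
      (auto simp: Lp_fun_def)
  moreover have "norm (f x + g x) powr p \<le> 2 powr p * (norm (f x) powr p + norm (g x) powr p)" for x
  proof -
    have "norm (f x + g x) powr p \<le> (2 * max (norm (f x)) (norm (g x))) powr p"
      using assms norm_triangle_ineq[of "f x" "g x"] by (intro powr_mono2) auto
    also have "\<dots> = 2 powr p * max (norm (f x)) (norm (g x)) powr p"
      by (simp add: powr_mult)
    also have "\<dots> \<le> 2 powr p * (norm (f x) powr p + norm (g x) powr p)"
      by (intro mult_left_mono) (auto simp: max_def)
    finally show ?thesis .
  qed
  ultimately have "integrable M (\<lambda>x. norm (f x + g x) powr p)"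
    by (elim Bochner_Integration.integrable_bound) auto
  then show ?thesis by (simp add: Lp_fun_def)
qed

lemma Lp_fun_scale:
  assumes "f \<in> Lp_fun p M"
  shows "(\<lambda>x. c * f x) \<in> Lp_fun p M"
  using assms by (auto simp: Lp_fun_def norm_mult powr_mult)

lemma vcarrier_Lp: "vcarrier (Lp p M) = Lp_class p M ` Lp_fun p M"
  by (auto simp: Lp_def Lp_class_def quotient_def)

lemma Lp_add_class:
  assumes "0 < p" "f \<in> Lp_fun p M" "g \<in> Lp_fun p M"
  shows "vadd (Lp p M) (Lp_class p M f) (Lp_class p M g) = Lp_class p M (\<lambda>x. f x + g x)"
proof -
  have "Lp_class p M (\<lambda>x. f' x + g' x) = Lp_class p M (\<lambda>x. f x + g x)"
    if "f' \<in> Lp_class p M f" "g' \<in> Lp_class p M g" for f' g'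
  proof (subst Lp_class_eq_iff)
    have "AE x in M. f x = f' x" "AE x in M. g x = g' x"
      using that by (auto simp: Lp_class_def Lp_rel_def)
    then show "AE x in M. f' x + g' x = f x + g x" by eventually_elim simp
  qed (use that assms in \<open>auto simp: Lp_class_def Lp_rel_def intro!: Lp_fun_add\<close>)
  then have "(\<Union>f'\<in>Lp_class p M f. \<Union>g'\<in>Lp_class p M g. Lp_class p M (\<lambda>x. f' x + g' x)) =
      Lp_class p M (\<lambda>x. f x + g x)"
    using mem_Lp_class[OF assms(2)] mem_Lp_class[OF assms(3)] by blast
  then show ?thesis by (simp add: Lp_def)
qed

lemma Lp_scale_class:
  assumes "f \<in> Lp_fun p M"
  shows "vscale (Lp p M) c (Lp_class p M f) = Lp_class p M (\<lambda>x. c * f x)"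
proof -
  have "Lp_class p M (\<lambda>x. c * f' x) = Lp_class p M (\<lambda>x. c * f x)"
    if "f' \<in> Lp_class p M f" for f'
  proof (subst Lp_class_eq_iff)
    have "AE x in M. f x = f' x"
      using that by (auto simp: Lp_class_def Lp_rel_def)
    then show "AE x in M. c * f' x = c * f x" by eventually_elim simp
  qed (use that assms in \<open>auto simp: Lp_class_def Lp_rel_def intro!: Lp_fun_scale\<close>)
  then have "(\<Union>f'\<in>Lp_class p M f. Lp_class p M (\<lambda>x. c * f' x)) = Lp_class p M (\<lambda>x. c * f x)"
    using mem_Lp_class[OF assms] by blast
  then show ?thesis by (simp add: Lp_def)
qed

lemma Lp_norm_class:
  assumes "f \<in> Lp_fun p M"
  shows "vnorm (Lp p M) (Lp_class p M f) = Lp_seminorm p M f"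
proof -
  have "Lp_seminorm p M g = Lp_seminorm p M f" if "g \<in> Lp_class p M f" for g
  proof -
    from that have g: "AE x in M. f x = g x" "g \<in> Lp_fun p M"
      by (auto simp: Lp_class_def Lp_rel_def)
    have "(LINT x|M. norm (g x) powr p) = (LINT x|M. norm (f x) powr p)"
    proof (rule integral_cong_AE)
      show "AE x in M. norm (g x) powr p = norm (f x) powr p"
        using g(1) by eventually_elim simp
    qed (use g assms in \<open>auto simp: Lp_fun_def\<close>)
    then show ?thesis by (simp add: Lp_seminorm_def)
  qed
  then have "Lp_seminorm p M ` Lp_class p M f = {Lp_seminorm p M f}"
    using mem_Lp_class[OF assms] by blast
  then show ?thesis by (simp add: Lp_def)
qed

lemma vcarrier_Lp0:
  "vcarrier (Lp0 p M) = Lp_class p M ` {f \<in> Lp_fun p M. (LINT x|M. f x) = 0}"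
proof -
  have int: "(LINT x|M. g x) = (LINT x|M. f x)"
    if "f \<in> Lp_fun p M" "g \<in> Lp_class p M f" for f g
  proof (rule integral_cong_AE)
    have "AE x in M. f x = g x"
      using that by (auto simp: Lp_class_def Lp_rel_def)
    then show "AE x in M. g x = f x" by eventually_elim simp
  qed (use that in \<open>auto simp: Lp_fun_def Lp_class_def Lp_rel_def\<close>)
  have "(\<forall>g\<in>Lp_class p M f. (LINT x|M. g x) = 0) \<longleftrightarrow> (LINT x|M. f x) = 0"
    if "f \<in> Lp_fun p M" for f
    using int[OF that] mem_Lp_class[OF that] by metis
  then show ?thesis
    by (auto simp: Lp0_def vcarrier_Lp)
qed

end

theory Submission imports Defs begin

text \<open>
  For \<open>p \<noteq> 2\<close>, equality in Clarkson's inequality characterises disjointness of supports in an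
  \<open>L\<^sup>p\<close>-space, so a linear isometry \<open>T\<close> of \<open>L\<^sup>p\<^sub>0\<close> onto \<open>L\<^sup>p(N)\<close> preserves disjointness in
  both directions. In \<open>L\<^sup>p(N)\<close> every vector is the sum of a vector disjoint from a given \<open>F\<close>
  and a vector disjoint from everything that is disjoint from \<open>F\<close>. In \<open>L\<^sup>p\<^sub>0\<close> this fails: if \<open>f\<close>
  has support \<open>A\<close> with \<open>A\<close> and its complement of positive measure, vectors of these two kinds
  are supported in the complement of \<open>A\<close> and in \<open>A\<close>, respectively, and both have mean zero, so
  their sums have mean zero on \<open>A\<close>.
\<close>

section \<open>Clarkson's inequality\<close>

lemma powr_midpoint_le:
  fixes q s t :: real
  assumes "1 \<le> q" "0 \<le> s" "0 \<le> t"
  shows "((s + t) / 2) powr q \<le> (s powr q + t powr q) / 2"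
proof -
  have half: "(x / 2) powr q \<le> x powr q / 2" if "0 \<le> x" for x :: real
  proof -
    have "(1 / 2) powr q \<le> (1 / 2 :: real) powr 1"
      using assms by (intro powr_mono') auto
    then have "x powr q * (1 / 2) powr q \<le> x powr q * (1 / 2)"
      by (intro mult_left_mono) auto
    moreover have "(x / 2) powr q = x powr q * (1 / 2) powr q"
      using that powr_mult[of x "1/2" q] by simp
    ultimately show ?thesis by simp
  qed
  \<comment> \<open>Convexity is applied only at positive arguments; if one argument is 0, the claim
    is \<open>half\<close>.\<close>
  consider "s = 0" | "t = 0" | "0 < s" "0 < t" using assms by linarith
  then show ?thesis
  proof cases
    case 3
    have "((1 - 1/2) *\<^sub>R s + (1/2) *\<^sub>R t) powr q \<le> (1 - 1/2) * s powr q + (1/2) * t powr q"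
      by (rule convex_onD[OF powr_convex[OF assms(1)]]) (use 3 in auto)
    then show ?thesis by (simp add: add_divide_distrib)
  qed (use half assms in auto)
qed

text \<open>Midpoint convexity for the exponent \<open>1 / q\<close>, which is at least 1, applied
  to \<open>s powr q\<close> and \<open>t powr q\<close>.\<close>

lemma powr_midpoint_ge:
  fixes q s t :: real
  assumes "0 < q" "q \<le> 1" "0 \<le> s" "0 \<le> t"
  shows "(s powr q + t powr q) / 2 \<le> ((s + t) / 2) powr q"
proof -
  have "((s powr q + t powr q) / 2) powr (1 / q)
      \<le> ((s powr q) powr (1 / q) + (t powr q) powr (1 / q)) / 2"
    using assms by (intro powr_midpoint_le) auto
  also have "\<dots> = (s + t) / 2" using assms by (simp add: powr_powr)
  finally have "(((s powr q + t powr q) / 2) powr (1 / q)) powr q \<le> ((s + t) / 2) powr q"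
    using assms by (intro powr_mono2) auto
  then show ?thesis using assms by (simp add: powr_powr)
qed

text \<open>The fractions \<open>x / (x + y)\<close> and \<open>y / (x + y)\<close> lie strictly
  between 0 and 1, so the power \<open>q > 1\<close> strictly decreases them, and they sum to
  1.\<close>

lemma powr_add_greater:
  fixes q x y :: real
  assumes "1 < q" "0 < x" "0 < y"
  shows "x powr q + y powr q < (x + y) powr q"
proof -
  have less: "z powr q < z / (x + y) * (x + y) powr q" if "0 < z" "z < x + y" for z
  proof -
    have "(z / (x + y)) powr q < (z / (x + y)) powr 1"
      using that assms by (intro powr_less_mono') auto
    then have "(z / (x + y)) powr q * (x + y) powr q < z / (x + y) * (x + y) powr q"
      using that assms by (intro mult_strict_right_mono) auto
    then show ?thesis using that assms by (simp add: powr_divide)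
  qed
  have "x powr q + y powr q < x / (x + y) * (x + y) powr q + y / (x + y) * (x + y) powr q"
    using assms by (intro add_strict_mono less) auto
  also have "\<dots> = (x / (x + y) + y / (x + y)) * (x + y) powr q"
    by (simp only: distrib_right)
  also have "\<dots> = (x + y) powr q"
    using assms by (simp flip: add_divide_distrib)
  finally show ?thesis .
qed

text \<open>Strict superadditivity for the exponent \<open>1 / q > 1\<close>, applied to
  \<open>x powr q\<close> and \<open>y powr q\<close>.\<close>

lemma powr_add_less:
  fixes q x y :: real
  assumes "0 < q" "q < 1" "0 < x" "0 < y"
  shows "(x + y) powr q < x powr q + y powr q"
proof -
  have "(x powr q) powr (1 / q) + (y powr q) powr (1 / q) < (x powr q + y powr q) powr (1 / q)"
    using assms by (intro powr_add_greater) auto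
  then have "x + y < (x powr q + y powr q) powr (1 / q)"
    using assms by (simp add: powr_powr)
  then have "(x + y) powr q < ((x powr q + y powr q) powr (1 / q)) powr q"
    using assms by (intro powr_less_mono2) auto
  then show ?thesis using assms by (simp add: powr_powr)
qed

text \<open>The pointwise defect in Clarkson's inequality. It vanishes identically for
  \<open>p = 2\<close>, by the parallelogram law; for every other positive \<open>p\<close> it has a
  fixed sign.\<close>

definition clarkson_gap :: "real \<Rightarrow> complex \<Rightarrow> complex \<Rightarrow> real" where
  "clarkson_gap p a b =
    norm (a + b) powr p + norm (a - b) powr p - 2 * norm a powr p - 2 * norm b powr p"

lemma clarkson_gap_zero: "a * b = 0 \<Longrightarrow> clarkson_gap p a b = 0"
  by (auto simp: clarkson_gap_def)

text \<open>Squares with exponent \<open>p / 2\<close> bring the powers within reach of the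
  parallelogram law.\<close>

lemma norm_powr_eq_square_powr: "norm a powr p = ((norm a)\<^sup>2) powr (p / 2)" for a :: complex
  by (simp add: powr_powr flip: powr_numeral)

lemma parallelogram_complex:
  "((norm (a + b))\<^sup>2 + (norm (a - b))\<^sup>2) / 2 = (norm a)\<^sup>2 + (norm b)\<^sup>2" for a b :: complex
  unfolding cmod_power2 by (simp add: power2_eq_square algebra_simps)

text \<open>For \<open>p / 2 > 1\<close>, superadditivity gives the strict step, since both squared
  norms are positive; the parallelogram law and midpoint convexity do the rest.\<close>

lemma clarkson_gap_pos:
  assumes "2 < p" "a * b \<noteq> 0"
  shows "0 < clarkson_gap p a b"
proof -
  have "((norm a)\<^sup>2) powr (p/2) + ((norm b)\<^sup>2) powr (p/2) < ((norm a)\<^sup>2 + (norm b)\<^sup>2) powr (p/2)"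
    using assms by (intro powr_add_greater) auto
  also have "\<dots> = (((norm (a + b))\<^sup>2 + (norm (a - b))\<^sup>2) / 2) powr (p/2)"
    by (simp only: parallelogram_complex)
  also have "\<dots> \<le> (((norm (a + b))\<^sup>2) powr (p/2) + ((norm (a - b))\<^sup>2) powr (p/2)) / 2"
    using assms by (intro powr_midpoint_le) auto
  finally show ?thesis
    unfolding clarkson_gap_def norm_powr_eq_square_powr by simp
qed

text \<open>The same chain reversed, by midpoint concavity and strict subadditivity for
  \<open>p / 2 < 1\<close>.\<close>

lemma clarkson_gap_neg:
  assumes "0 < p" "p < 2" "a * b \<noteq> 0"
  shows "clarkson_gap p a b < 0"
proof -
  have "(((norm (a + b))\<^sup>2) powr (p/2) + ((norm (a - b))\<^sup>2) powr (p/2)) / 2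
      \<le> (((norm (a + b))\<^sup>2 + (norm (a - b))\<^sup>2) / 2) powr (p/2)"
    using assms by (intro powr_midpoint_ge) auto
  also have "\<dots> = ((norm a)\<^sup>2 + (norm b)\<^sup>2) powr (p/2)"
    by (simp only: parallelogram_complex)
  also have "\<dots> < ((norm a)\<^sup>2) powr (p/2) + ((norm b)\<^sup>2) powr (p/2)"
    using assms by (intro powr_add_less) auto
  finally show ?thesis
    unfolding clarkson_gap_def norm_powr_eq_square_powr by simp
qed


section \<open>Disjointness in Lebesgue spaces\<close>

lemma Lp_fun_uminus: "f \<in> Lp_fun p M \<Longrightarrow> (\<lambda>x. - f x) \<in> Lp_fun p M"
  using Lp_fun_scale[of f p M "-1"] by simp

lemma Lp_fun_diff:
  assumes "0 < p" "f \<in> Lp_fun p M" "g \<in> Lp_fun p M"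
  shows "(\<lambda>x. f x - g x) \<in> Lp_fun p M"
  using Lp_fun_add[OF assms(1,2) Lp_fun_uminus[OF assms(3)]] by simp

lemma Lp_fun_mult_indicator:
  assumes "f \<in> Lp_fun p M" "A \<in> sets M"
  shows "(\<lambda>x. f x * indicator A x) \<in> Lp_fun p M"
proof -
  have [measurable]: "f \<in> borel_measurable M" "A \<in> sets M"
    using assms by (auto simp: Lp_fun_def)
  have "integrable M (\<lambda>x. norm (f x) powr p)" using assms by (simp add: Lp_fun_def)
  then have "integrable M (\<lambda>x. norm (f x * indicator A x) powr p)"
    by (rule Bochner_Integration.integrable_bound) (auto simp: indicator_def)
  then show ?thesis by (simp add: Lp_fun_def)
qed

lemma Lp_seminorm_powr:
  assumes "p \<noteq> 0"
  shows "Lp_seminorm p M f powr p = (LINT x|M. norm (f x) powr p)"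
  using assms by (simp add: Lp_seminorm_def powr_powr)

lemma Lp_seminorm_eq_0_iff:
  assumes "f \<in> Lp_fun p M"
  shows "Lp_seminorm p M f = 0 \<longleftrightarrow> (AE x in M. f x = 0)"
  using assms by (simp add: Lp_seminorm_def Lp_fun_def integral_nonneg_eq_0_iff_AE)

lemma Lp_seminorm_cong_AE:
  assumes "f \<in> Lp_fun p M" "g \<in> Lp_fun p M" "AE x in M. f x = g x"
  shows "Lp_seminorm p M f = Lp_seminorm p M g"
  by (metis Lp_class_eq_iff Lp_norm_class assms)

text \<open>The difference of the two sides is the integral of the gap. As the gap has constant
  sign, its integral is zero iff the gap is zero almost everywhere, and the gap is zero exactly
  where the product is.\<close>

lemma AE_disjoint_iff_seminorm:
  assumes p: "0 < p" "p \<noteq> 2" and f: "f \<in> Lp_fun p M" and g: "g \<in> Lp_fun p M"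
  shows "(AE x in M. f x * g x = 0) \<longleftrightarrow>
    Lp_seminorm p M (\<lambda>x. f x + g x) powr p + Lp_seminorm p M (\<lambda>x. f x - g x) powr p =
    2 * Lp_seminorm p M f powr p + 2 * Lp_seminorm p M g powr p"
proof -
  let ?D = "\<lambda>x. clarkson_gap p (f x) (g x)"
  have int: "integrable M (\<lambda>x. norm (f x) powr p)" "integrable M (\<lambda>x. norm (g x) powr p)"
    "integrable M (\<lambda>x. norm (f x + g x) powr p)" "integrable M (\<lambda>x. norm (f x - g x) powr p)"
    using f g Lp_fun_add[OF p(1) f g] Lp_fun_diff[OF p(1) f g] by (auto simp: Lp_fun_def)
  have D: "integrable M ?D"
    unfolding clarkson_gap_def using int by auto
  have "(LINT x|M. ?D x) =
      Lp_seminorm p M (\<lambda>x. f x + g x) powr p + Lp_seminorm p M (\<lambda>x. f x - g x) powr p -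
      2 * Lp_seminorm p M f powr p - 2 * Lp_seminorm p M g powr p"
    unfolding clarkson_gap_def using p int by (simp add: Lp_seminorm_powr)
  moreover have "(LINT x|M. ?D x) = 0 \<longleftrightarrow> (AE x in M. ?D x = 0)"
  proof (cases "2 < p")
    case True
    then have "0 \<le> ?D x" for x
      using clarkson_gap_pos clarkson_gap_zero by (metis less_eq_real_def)
    then show ?thesis by (intro integral_nonneg_eq_0_iff_AE D) auto
  next
    case False
    then have "0 \<le> - ?D x" for x
      using p clarkson_gap_neg[of p "f x" "g x"] clarkson_gap_zero[of "f x" "g x" p] by fastforce
    then have "(LINT x|M. - ?D x) = 0 \<longleftrightarrow> (AE x in M. - ?D x = 0)"
      by (intro integral_nonneg_eq_0_iff_AE Bochner_Integration.integrable_minus D) auto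
    then show ?thesis by simp
  qed
  moreover have "?D x = 0 \<longleftrightarrow> f x * g x = 0" for x
    using p clarkson_gap_pos[of p "f x" "g x"] clarkson_gap_neg[of p "f x" "g x"]
      clarkson_gap_zero[of "f x" "g x" p] by (metis less_irrefl linorder_neqE_linordered_idom)
  ultimately show ?thesis by auto
qed


section \<open>Isometries of mean-zero spaces onto Lebesgue spaces\<close>

text \<open>Representatives of the vectors of \<open>Lp0\<close>, so that the argument can work with
  functions in place of classes.\<close>

definition Lp0_fun :: "real \<Rightarrow> 'a measure \<Rightarrow> ('a \<Rightarrow> complex) set" where
  "Lp0_fun p M = {f \<in> Lp_fun p M. (LINT x|M. f x) = 0}"

text \<open>The bound is \<open>1 + norm (f x) powr p\<close>. Integrability matters for adding
  means, because the Bochner integral of a non-integrable function is 0 by default.\<close>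

lemma (in finite_measure) Lp_fun_integrable:
  assumes "1 \<le> p" "f \<in> Lp_fun p M"
  shows "integrable M f"
proof -
  have "integrable M (\<lambda>x. 1 + norm (f x) powr p)"
    using assms by (auto simp: Lp_fun_def)
  moreover have "norm (f x) \<le> 1 + norm (f x) powr p" for x
  proof (cases "1 \<le> norm (f x)")
    case True
    then have "norm (f x) powr 1 \<le> norm (f x) powr p" using assms by (intro powr_mono) auto
    then show ?thesis using True by simp
  qed (auto intro: add_increasing2)
  ultimately show ?thesis
    using assms by (elim Bochner_Integration.integrable_bound) (auto simp: Lp_fun_def)
qed

lemma (in finite_measure) Lp0_fun_add:
  assumes "1 \<le> p" "f \<in> Lp0_fun p M" "g \<in> Lp0_fun p M"
  shows "(\<lambda>x. f x + g x) \<in> Lp0_fun p M"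
proof -
  have "f \<in> Lp_fun p M" "g \<in> Lp_fun p M" "0 < p" using assms by (auto simp: Lp0_fun_def)
  then show ?thesis
    using assms Lp_fun_add[of p f M g] by (simp add: Lp0_fun_def Lp_fun_integrable)
qed

lemma Lp0_fun_uminus: "f \<in> Lp0_fun p M \<Longrightarrow> (\<lambda>x. - f x) \<in> Lp0_fun p M"
  by (simp add: Lp0_fun_def Lp_fun_uminus)

text \<open>A choice of representatives: \<open>S\<close> inherits additivity from the isometry of
  classes up to null sets. Negation and sums together yield the differences in Clarkson's
  inequality.\<close>

lemma (in finite_measure) isometrically_isomorphic_Lp0_LpE:
  fixes N :: "'b measure"
  assumes "1 \<le> p" "isometrically_isomorphic (Lp0 p M) (Lp p N)"
  obtains S where
    "\<And>f. f \<in> Lp0_fun p M \<Longrightarrow> S f \<in> Lp_fun p N"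
    "\<And>u. u \<in> Lp_fun p N \<Longrightarrow> \<exists>f\<in>Lp0_fun p M. AE y in N. S f y = u y"
    "\<And>f g. f \<in> Lp0_fun p M \<Longrightarrow> g \<in> Lp0_fun p M \<Longrightarrow>
      AE y in N. S (\<lambda>x. f x + g x) y = S f y + S g y"
    "\<And>f. f \<in> Lp0_fun p M \<Longrightarrow> AE y in N. S (\<lambda>x. - f x) y = - S f y"
    "\<And>f. f \<in> Lp0_fun p M \<Longrightarrow> Lp_seminorm p N (S f) = Lp_seminorm p M f"
proof -
  let ?c = "Lp_class p M" and ?d = "Lp_class p N"
  have p: "0 < p" using assms by simp
  have car: "vcarrier (Lp0 p M) = ?c ` Lp0_fun p M"
    by (simp add: vcarrier_Lp0 Lp0_fun_def)
  have ops: "vadd (Lp0 p M) = vadd (Lp p M)" "vscale (Lp0 p M) = vscale (Lp p M)"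
    "vnorm (Lp0 p M) = vnorm (Lp p M)"
    by (simp_all add: Lp0_def)
  have sub: "f \<in> Lp_fun p M" if "f \<in> Lp0_fun p M" for f using that by (simp add: Lp0_fun_def)
  obtain T where onto: "T ` ?c ` Lp0_fun p M = ?d ` Lp_fun p N"
    and add: "\<forall>u\<in>?c ` Lp0_fun p M. \<forall>v\<in>?c ` Lp0_fun p M.
      T (vadd (Lp p M) u v) = vadd (Lp p N) (T u) (T v)"
    and scale: "\<forall>c. \<forall>u\<in>?c ` Lp0_fun p M. T (vscale (Lp p M) c u) = vscale (Lp p N) c (T u)"
    and norm: "\<forall>u\<in>?c ` Lp0_fun p M. vnorm (Lp p N) (T u) = vnorm (Lp p M) u"
    using assms(2) unfolding isometrically_isomorphic_def car ops vcarrier_Lp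
    by (elim exE conjE) (rule that)
  have "\<forall>f\<in>Lp0_fun p M. \<exists>g\<in>Lp_fun p N. T (?c f) = ?d g"
    using onto by blast
  then obtain S where S: "\<And>f. f \<in> Lp0_fun p M \<Longrightarrow> S f \<in> Lp_fun p N"
    and T: "\<And>f. f \<in> Lp0_fun p M \<Longrightarrow> T (?c f) = ?d (S f)"
    by metis
  show thesis
  proof (rule that[of S])
    fix u assume u: "u \<in> Lp_fun p N"
    then obtain f where "f \<in> Lp0_fun p M" "?d u = T (?c f)"
      using onto by (metis (no_types, lifting) imageE image_eqI)
    then show "\<exists>f\<in>Lp0_fun p M. AE y in N. S f y = u y"
      using u S T Lp_class_eq_iff by metis
  next
    fix f g assume fg: "f \<in> Lp0_fun p M" "g \<in> Lp0_fun p M"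
    then have sum: "(\<lambda>x. f x + g x) \<in> Lp0_fun p M" by (rule Lp0_fun_add[OF assms(1)])
    have "?d (S (\<lambda>x. f x + g x)) = T (vadd (Lp p M) (?c f) (?c g))"
      using fg by (simp add: T[OF sum, symmetric] Lp_add_class p sub)
    also have "\<dots> = ?d (\<lambda>y. S f y + S g y)"
      using fg by (simp add: add T Lp_add_class p S)
    finally show "AE y in N. S (\<lambda>x. f x + g x) y = S f y + S g y"
      using fg S sum by (subst (asm) Lp_class_eq_iff) (auto intro: Lp_fun_add p)
  next
    fix f assume f: "f \<in> Lp0_fun p M"
    then have um: "(\<lambda>x. - f x) \<in> Lp0_fun p M" by (rule Lp0_fun_uminus)
    have "?d (S (\<lambda>x. - f x)) = T (vscale (Lp p M) (- 1) (?c f))"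
      using f by (simp add: T[OF um, symmetric] Lp_scale_class sub)
    also have "\<dots> = ?d (\<lambda>y. - S f y)"
      using f by (simp add: scale T Lp_scale_class S)
    finally show "AE y in N. S (\<lambda>x. - f x) y = - S f y"
      using f S um by (subst (asm) Lp_class_eq_iff) (auto intro: Lp_fun_uminus)
  next
    fix f assume f: "f \<in> Lp0_fun p M"
    then show "Lp_seminorm p N (S f) = Lp_seminorm p M f"
      using bspec[OF norm, of "?c f"] by (simp add: T Lp_norm_class S sub)
  qed (rule S)
qed

lemma (in prob_space) indicator_diff_Lp0_fun:
  assumes [measurable]: "A \<in> sets M" "B \<in> sets M" and "prob A = prob B"
  shows "(\<lambda>x. complex_of_real (indicator A x - indicator B x)) \<in> Lp0_fun p M"
proof -
  have "integrable M (\<lambda>x. norm (complex_of_real (indicator A x - indicator B x)) powr p)"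
    by (rule integrable_const_bound[where B = 1]) (auto simp: indicator_def)
  moreover have "(LINT x|M. complex_of_real (indicator A x - indicator B x)) = 0"
    using assms by (subst integral_complex_of_real, subst Bochner_Integration.integral_diff)
      (auto simp: integrable_real_indicator emeasure_eq_measure)
  ultimately show ?thesis
    by (simp add: Lp0_fun_def Lp_fun_def)
qed

text \<open>The support in question is \<open>A \<union> B\<close>. Halving it and its complement
  supplies mean-zero functions with exactly these supports; a single function on
  \<open>C \<union> D\<close> stands for all vectors disjoint from \<open>f\<close>.\<close>

lemma (in prob_space) not_isometrically_isomorphic_Lp0_Lp:
  fixes N :: "'b measure"
  assumes p: "1 \<le> p" "p \<noteq> 2"
    and sets: "A \<in> sets M" "B \<in> sets M" "C \<in> sets M" "D \<in> sets M"
    and disj: "A \<inter> B = {}" "C \<inter> D = {}" "(A \<union> B) \<inter> (C \<union> D) = {}"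
    and cover: "A \<union> B \<union> C \<union> D = space M"
    and prob: "prob A = prob B" "prob C = prob D" "prob (A \<union> B) = prob (C \<union> D)"
  shows "\<not> isometrically_isomorphic (Lp0 p M) (Lp p N)"
proof
  note [measurable] = sets
  assume "isometrically_isomorphic (Lp0 p M) (Lp p N)"
  then obtain S where S: "\<And>f. f \<in> Lp0_fun p M \<Longrightarrow> S f \<in> Lp_fun p N"
    and onto: "\<And>u. u \<in> Lp_fun p N \<Longrightarrow> \<exists>f\<in>Lp0_fun p M. AE y in N. S f y = u y"
    and add: "\<And>f g. f \<in> Lp0_fun p M \<Longrightarrow> g \<in> Lp0_fun p M \<Longrightarrow>
      AE y in N. S (\<lambda>x. f x + g x) y = S f y + S g y"
    and minus: "\<And>f. f \<in> Lp0_fun p M \<Longrightarrow> AE y in N. S (\<lambda>x. - f x) y = - S f y"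
    and norm: "\<And>f. f \<in> Lp0_fun p M \<Longrightarrow> Lp_seminorm p N (S f) = Lp_seminorm p M f"
    by (rule isometrically_isomorphic_Lp0_LpE[OF p(1)]) (rule that)
  have p0: "0 < p" using p by simp
  have sub: "f \<in> Lp_fun p M" if "f \<in> Lp0_fun p M" for f using that by (simp add: Lp0_fun_def)
  have diff_mem: "(\<lambda>x. f x - g x) \<in> Lp0_fun p M"
    if "f \<in> Lp0_fun p M" "g \<in> Lp0_fun p M" for f g
    using Lp0_fun_add[OF p(1) that(1) Lp0_fun_uminus[OF that(2)]] by simp
  have diff: "AE y in N. S (\<lambda>x. f x - g x) y = S f y - S g y"
    if "f \<in> Lp0_fun p M" "g \<in> Lp0_fun p M" for f g
    using add[OF that(1) Lp0_fun_uminus[OF that(2)]] minus[OF that(2)]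
    by eventually_elim simp
  \<comment> \<open>The isometry preserves all four norms in Clarkson's equality, so disjointness
    passes in both directions.\<close>
  have disjoint: "(AE y in N. S f y * S g y = 0) \<longleftrightarrow> (AE x in M. f x * g x = 0)"
    if fg: "f \<in> Lp0_fun p M" "g \<in> Lp0_fun p M" for f g
  proof -
    have "Lp_seminorm p N (\<lambda>y. S f y + S g y) = Lp_seminorm p M (\<lambda>x. f x + g x)"
      using Lp_seminorm_cong_AE[OF S[OF Lp0_fun_add[OF p(1) fg]] _ add[OF fg]] fg
      by (simp add: Lp_fun_add p0 S Lp0_fun_add[OF p(1)] norm)
    moreover have "Lp_seminorm p N (\<lambda>y. S f y - S g y) = Lp_seminorm p M (\<lambda>x. f x - g x)"
      using Lp_seminorm_cong_AE[OF S[OF diff_mem[OF fg]] _ diff[OF fg]] fg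
      by (simp add: Lp_fun_diff p0 S diff_mem norm)
    ultimately show ?thesis
      using AE_disjoint_iff_seminorm[OF p0 p(2) S S, OF fg]
        AE_disjoint_iff_seminorm[OF p0 p(2) sub sub, OF fg] fg by (simp add: norm)
  qed
  \<comment> \<open>\<open>f\<close> and \<open>k\<close> are nonzero exactly on
    \<open>A \<union> B\<close> and \<open>C \<union> D\<close>; \<open>h\<close> is 1 on the first
    set and -1 on the second.\<close>
  define f where "f = (\<lambda>x. complex_of_real (indicator A x - indicator B x))"
  define k where "k = (\<lambda>x. complex_of_real (indicator C x - indicator D x))"
  define h where "h = (\<lambda>x. complex_of_real (indicator (A \<union> B) x - indicator (C \<union> D) x))"
  have f: "f \<in> Lp0_fun p M" and k: "k \<in> Lp0_fun p M" and h: "h \<in> Lp0_fun p M"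
    unfolding f_def k_def h_def by (intro indicator_diff_Lp0_fun sets.Un sets prob)+
  have [measurable]: "S f \<in> borel_measurable N" using S[OF f] by (simp add: Lp_fun_def)
  \<comment> \<open>\<open>S h\<close> is cut along the support \<open>E\<close> of
    \<open>S f\<close>; surjectivity pulls both pieces back to mean-zero functions \<open>h1\<close>
    and \<open>h2\<close>.\<close>
  define E where "E = {y \<in> space N. S f y \<noteq> 0}"
  have [measurable]: "E \<in> sets N" unfolding E_def by measurable
  obtain h1 where h1: "h1 \<in> Lp0_fun p M" and Sh1: "AE y in N. S h1 y = S h y * indicator E y"
    using onto[OF Lp_fun_mult_indicator[OF S[OF h] \<open>E \<in> sets N\<close>]] by auto
  obtain h2 where h2: "h2 \<in> Lp0_fun p M"
    and Sh2: "AE y in N. S h2 y = S h y * indicator (space N - E) y"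
    using onto[OF Lp_fun_mult_indicator[OF S[OF h], of "space N - E"]] by auto
  \<comment> \<open>This makes \<open>h2\<close> vanish almost everywhere on
    \<open>A \<union> B\<close>.\<close>
  have "AE y in N. S h2 y * S f y = 0"
    using Sh2 AE_space by eventually_elim (auto simp: E_def indicator_def)
  then have h2f: "AE x in M. h2 x * f x = 0" using disjoint h2 f by blast
  \<comment> \<open>\<open>S k\<close> vanishes almost everywhere on \<open>E\<close> and
    \<open>S h1\<close> off \<open>E\<close>, so they are disjoint; hence \<open>h1\<close> vanishes
    almost everywhere on \<open>C \<union> D\<close>.\<close>
  have "AE x in M. k x * f x = 0"
    using disj by (intro AE_I2) (auto simp: k_def f_def indicator_def)
  then have "AE y in N. S k y * S f y = 0" using disjoint k f by blast
  then have "AE y in N. S h1 y * S k y = 0"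
    using Sh1 by eventually_elim (auto simp: E_def indicator_def)
  then have h1k: "AE x in M. h1 x * k x = 0" using disjoint h1 k by blast
  have h12: "(\<lambda>x. h1 x + h2 x) \<in> Lp0_fun p M" by (rule Lp0_fun_add[OF p(1) h1 h2])
  \<comment> \<open>Injectivity of the isometry, by way of the norm, turns the splitting of
    \<open>S h\<close> into \<open>h = h1 + h2\<close> almost everywhere.\<close>
  have "AE y in N. S (\<lambda>x. h x - (h1 x + h2 x)) y = 0"
    using diff[OF h h12] add[OF h1 h2] Sh1 Sh2 AE_space
    by eventually_elim (auto simp: indicator_def)
  then have "Lp_seminorm p M (\<lambda>x. h x - (h1 x + h2 x)) = 0"
    using Lp_seminorm_eq_0_iff[OF S] norm diff_mem[OF h h12] by metis
  then have "AE x in M. h x - (h1 x + h2 x) = 0"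
    using Lp_seminorm_eq_0_iff[OF sub[OF diff_mem[OF h h12]]] by simp
  then have "AE x in M. h1 x = complex_of_real (indicator (A \<union> B) x)"
    using h2f h1k AE_space
  proof eventually_elim
    case (elim x)
    then consider "x \<in> A \<union> B" | "x \<in> C \<union> D" using cover by auto
    then show ?case
    proof cases
      case 1
      then have "f x \<noteq> 0" "h x = 1" using disj by (auto simp: f_def h_def indicator_def)
      then show ?thesis using elim 1 by auto
    next
      case 2
      then have "k x \<noteq> 0" "x \<notin> A \<union> B" using disj by (auto simp: k_def indicator_def)
      then show ?thesis using elim by auto
    qed
  qed
  \<comment> \<open>The mean of \<open>h1\<close> is zero, yet it equals the probability of one of
    two equally likely halves of the space.\<close>
  then have "(LINT x|M. h1 x) = (LINT x|M. complex_of_real (indicator (A \<union> B) x))"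
    using h1 by (intro integral_cong_AE) (auto simp: Lp0_fun_def Lp_fun_def)
  also have "\<dots> = complex_of_real (prob (A \<union> B))"
    by (subst integral_complex_of_real) simp
  finally have "prob (A \<union> B) = 0" using h1 by (simp add: Lp0_fun_def)
  moreover have "prob (A \<union> B) + prob (C \<union> D) = prob (space M)"
    using disj cover by (subst finite_measure_Union[symmetric]) (auto simp: Un_assoc)
  ultimately show False using prob by (simp add: prob_space)
qed


section \<open>Quartering a diffuse standard probability space\<close>

text \<open>Preimages under the isomorphism are a priori measurable only for the completion;
  \<open>main_part\<close> shrinks them to sets of \<open>M\<close> of the same measure, which keeps
  them disjoint.\<close>

lemma isomorphic_mod_0_disjoint_family:
  assumes "isomorphic_mod_0 M N" "\<And>i. i \<in> I \<Longrightarrow> X i \<in> sets N" "disjoint_family_on X I"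
  obtains Y where "\<And>i. i \<in> I \<Longrightarrow> Y i \<in> sets M" "disjoint_family_on Y I"
    "\<And>i. i \<in> I \<Longrightarrow> emeasure M (Y i) = emeasure N (X i)"
proof -
  obtain A B f where A: "A \<in> sets (completion M)" and B: "B \<in> sets (completion N)"
    and nullB: "space N - B \<in> null_sets (completion N)"
    and f: "f \<in> measurable (restrict_space (completion M) A) (restrict_space (completion N) B)"
    and distr: "distr (restrict_space (completion M) A) (restrict_space (completion N) B) f =
      restrict_space (completion N) B"
    using assms(1) unfolding isomorphic_mod_0_def Let_def by (elim bexE exE conjE) (rule that)
  let ?MA = "restrict_space (completion M) A" and ?NB = "restrict_space (completion N) B"
  have AM: "A \<inter> space (completion M) \<in> sets (completion M)"
    and BN: "B \<inter> space (completion N) \<in> sets (completion N)"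
    using A B by auto
  have spA: "space ?MA = A" and spB: "space ?NB = B"
    using sets.sets_into_space[OF A] sets.sets_into_space[OF B] by (auto simp: space_restrict_space)
  define Z where "Z i = f -` (X i \<inter> B) \<inter> A" for i
  have XB: "X i \<inter> B \<in> sets ?NB" if "i \<in> I" for i
    using assms(2)[OF that] B BN by (auto simp: sets_restrict_space_iff)
  have ZMA: "Z i \<in> sets ?MA" if "i \<in> I" for i
    using measurable_sets[OF f XB[OF that]] by (simp add: Z_def spA)
  then have Z: "Z i \<in> sets (completion M)" if "i \<in> I" for i
    using that AM by (simp add: sets_restrict_space_iff)
  have "emeasure M (main_part M (Z i)) = emeasure N (X i)" if i: "i \<in> I" for i
  proof -
    have "emeasure M (main_part M (Z i)) = emeasure (completion M) (Z i)"
      using Z[OF i] by simp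
    also have "\<dots> = emeasure ?MA (Z i)"
      using AM by (subst emeasure_restrict_space) (auto simp: Z_def)
    also have "\<dots> = emeasure (distr ?MA ?NB f) (X i \<inter> B)"
      using f XB[OF i] by (subst emeasure_distr) (auto simp: Z_def spA)
    also have "\<dots> = emeasure (completion N) (X i \<inter> B)"
      using BN by (simp add: distr emeasure_restrict_space)
    \<comment> \<open>\<open>B\<close> is conull, so intersecting with it leaves the measure
      unchanged.\<close>
    also have "\<dots> = emeasure (completion N) (X i - (space N - B))"
      using sets.sets_into_space[OF assms(2)[OF i]] by (intro arg_cong2[where f = emeasure]) auto
    also have "\<dots> = emeasure (completion N) (X i)"
      using assms(2)[OF i] nullB by (intro emeasure_Diff_null_set) auto
    finally show ?thesis using assms(2)[OF i] by simp
  qed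
  moreover have "main_part M (Z i) \<subseteq> Z i" if "i \<in> I" for i
    using main_part_null_part_Un[OF Z[OF that]] by blast
  then have "disjoint_family_on (\<lambda>i. main_part M (Z i)) I"
    using assms(3) unfolding disjoint_family_on_def Z_def by blast
  ultimately show thesis
    using that[of "\<lambda>i. main_part M (Z i)"] Z by auto
qed

theorem theorem5:
  fixes M :: "'a measure" and N :: "'b measure" and p :: real
  assumes "diffuse_standard_prob_space M"
    and "1 \<le> p" and "p \<notin> {2 * real k | k. k \<ge> 1}"
    and "sigma_finite_measure N"
  shows "\<not> isometrically_isomorphic (Lp0 p M) (Lp p N)"
proof -
  interpret prob_space M using assms(1) by (simp add: diffuse_standard_prob_space_def)
  have "p \<noteq> 2" using assms(3) by force
  \<comment> \<open>Half-open quarters are genuinely disjoint. The first three are pulled back to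
    \<open>M\<close>.\<close>
  define X where "X i = {real i / 4 ..< real (Suc i) / 4}" for i
  have "isomorphic_mod_0 M (lebesgue_on {0..1::real})"
    using assms(1) by (simp add: diffuse_standard_prob_space_def)
  moreover have sub: "X i \<subseteq> {0..1}" if "i \<in> {..<3}" for i
    using that by (auto simp: X_def)
  then have "X i \<in> sets (lebesgue_on {0..1})" if "i \<in> {..<3}" for i
    using that by (subst sets_restrict_space_iff) (auto simp: X_def)
  moreover have "disjoint_family_on X {..<3}"
    unfolding disjoint_family_on_def
  proof (intro ballI impI)
    fix i j :: nat assume "i \<noteq> j"
    then have "real (Suc i) \<le> real j \<or> real (Suc j) \<le> real i"
      by (metis Suc_leI linorder_neqE_nat of_nat_le_iff)
    then show "X i \<inter> X j = {}" by (auto simp: X_def)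
  qed
  ultimately obtain Y where Y: "\<And>i. i \<in> {..<3} \<Longrightarrow> Y i \<in> sets M" "disjoint_family_on Y {..<3}"
    and eY: "\<And>i. i \<in> {..<3} \<Longrightarrow> emeasure M (Y i) = emeasure (lebesgue_on {0..1}) (X i)"
    by (rule isomorphic_mod_0_disjoint_family) (assumption | rule that)+
  have "prob (Y i) = 1 / 4" if "i \<in> {..<3}" for i
  proof -
    have "emeasure M (Y i) = emeasure lebesgue (X i)"
      using that sub by (simp add: eY emeasure_restrict_space)
    also have "\<dots> = ennreal (1 / 4)"
      by (simp add: X_def flip: diff_divide_distrib)
    finally show ?thesis by (simp add: measure_def)
  qed
  then have pY: "prob (Y 0) = 1 / 4" "prob (Y 1) = 1 / 4" "prob (Y 2) = 1 / 4" by auto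
  let ?A = "Y 0" and ?B = "Y 1" and ?C = "Y 2"
  have sets [measurable]: "?A \<in> sets M" "?B \<in> sets M" "?C \<in> sets M" using Y(1) by auto
  have disj: "?A \<inter> ?B = {}" "?A \<inter> ?C = {}" "?B \<inter> ?C = {}"
    using Y(2) by (auto simp: disjoint_family_on_def)
  have AB: "prob (?A \<union> ?B) = 1 / 2"
    using pY disj sets by (subst finite_measure_Union) auto
  have ABC: "prob (?A \<union> ?B \<union> ?C) = 3 / 4"
    using pY disj sets AB by (subst finite_measure_Union) auto
  \<comment> \<open>Taking the complement as the fourth set makes the four sets cover
    \<open>space M\<close> exactly, null sets included.\<close>
  let ?D = "space M - (?A \<union> ?B \<union> ?C)"
  have D: "prob ?D = 1 / 4"
    using ABC sets by (subst prob_compl) auto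
  have CD: "prob (?C \<union> ?D) = 1 / 2"
    using pY sets D by (subst finite_measure_Union) auto
  show ?thesis
    by (rule not_isometrically_isomorphic_Lp0_Lp[OF assms(2) \<open>p \<noteq> 2\<close>, of ?A ?B ?C ?D])
      (use sets disj pY AB D CD sets[THEN sets.sets_into_space] in auto)
qed

end
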